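(* Let $V_1, V_2$ be positive integers with $\gcd(V_1,V_2)=1$ and let $(V_m)_{m\ge 1}$ satisfy $V_m=V_{m-1}+V_{m-2}$ for $m\ge 3$. Let $n$ be a positive integer and $S=\langle V_n,V_{n+2},V_{n+4},\ldots\rangle$. Then the Apéry set of $S$ with respect to $V_n$ is \[ \mathrm{Ap}(S,V_n)=\{s(x): 1\le x\le V_n-1\}\cup\{0\}. \]
   Context: For a set $A$ of positive integers, $\langle A\rangle$ denotes the set of all finite linear combinations of elements of $A$ with non-negative integer coefficients. For $a\in S$, $a>0$, $\mathrm{Ap}(S,a)=\{m\in S: m-a\notin S\}$. $F_m$ denotes the Fibonacci sequence: $F_0=0$, $F_1=F_2=1$, $F_m=F_{m-1}+F_{m-2}$. Definition of $s(x)$ (depending on the sequence $(V_m)$ and on $n$): for a positive integer $x$, let $k\ge1$ be such that $F_{2k}\le x<F_{2k+2}$, and define $\lambda_k,\lambda_{k-1},\ldots,\lambda_1$ by the greedy algorithm with respect to $F_2,F_4,\ldots,F_{2k}$: $\lambda_k=\lfloor x/F_{2k}\rfloor$ and $\lambda_j=\left\lfloor \left(x-\sum_{i=j+1}^k\lambda_iF_{2i}\right)/F_{2j}\right\rfloor$ for $j=k-1,\ldots,1$; then $x=\sum_{i=1}^k\lambda_iF_{2i}$, and one sets $s(x)=\sum_{i=1}^k\lambda_iV_{n+2i}$. *)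

theory Defs
  imports Complex_Main "HOL-Number_Theory.Fib"
begin

definition nonneg_combinations :: "nat set \<Rightarrow> nat set" where
  "nonneg_combinations A = {(\<Sum>a\<in>B. c a * a) | B c. finite B \<and> B \<subseteq> A}"

(* The difference m - a is taken in the integers: truncated subtraction would wrongly
   exclude every element m of S with m < a. *)
definition apery_set :: "nat set \<Rightarrow> nat \<Rightarrow> nat set" where
  "apery_set S a = {m \<in> S. int m - int a \<notin> int ` S}"

definition greedy_top :: "nat \<Rightarrow> nat" where
  "greedy_top x = (THE k. 1 \<le> k \<and> fib (2 * k) \<le> x \<and> x < fib (2 * k + 2))"

(* greedy_coeff x k j is lambda_j, for j in {1..k}; values at other j are irrelevant.  The
   natural-number subtraction does not truncate, see greedy_sum_le below. *)
function greedy_coeff :: "nat \<Rightarrow> nat \<Rightarrow> nat \<Rightarrow> nat" where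
  "greedy_coeff x k j =
     (x - (\<Sum>i\<in>{j+1..k}. greedy_coeff x k i * fib (2 * i))) div fib (2 * j)"
  by auto
termination
  by (relation "measure (\<lambda>(x, k, j). k - j)") auto

declare greedy_coeff.simps [simp del]

definition greedy_s :: "(nat \<Rightarrow> nat) \<Rightarrow> nat \<Rightarrow> nat \<Rightarrow> nat" where
  "greedy_s V n x =
     (\<Sum>i = 1..greedy_top x. greedy_coeff x (greedy_top x) i * V (n + 2 * i))"

lemma greedy_top_ex1:
  assumes "x > 0"
  shows "\<exists>!k. 1 \<le> k \<and> fib (2 * k) \<le> x \<and> x < fib (2 * k + 2)"
proof (rule ex_ex1I)
  have unbounded: "m \<le> fib (2 * m)" for m
  proof (induction m)
    case (Suc m)
    have "fib (2 * m + 1) > 0" by (rule fib_neq_0_nat) simp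
    then show ?case using Suc by (simp add: numeral_2_eq_2)
  qed simp
  define k where "k = (LEAST k. x < fib (2 * k + 2))"
  have "x < fib (2 * x + 2)" using unbounded [of "Suc x"] by simp
  then have 1: "x < fib (2 * k + 2)" unfolding k_def by (rule LeastI)
  have k: "k \<noteq> 0"
    using 1 assms by (intro notI) (simp add: numeral_2_eq_2)
  then have "\<not> x < fib (2 * (k - 1) + 2)"
    unfolding k_def by (intro not_less_Least) simp
  moreover have "2 * (k - 1) + 2 = 2 * k" using k by simp
  ultimately have "fib (2 * k) \<le> x" by (metis not_less)
  then show "\<exists>k. 1 \<le> k \<and> fib (2 * k) \<le> x \<and> x < fib (2 * k + 2)"
    using 1 k by (intro exI [of _ k]) auto
next
  fix k l
  assume a: "1 \<le> k \<and> fib (2 * k) \<le> x \<and> x < fib (2 * k + 2)"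
    and b: "1 \<le> l \<and> fib (2 * l) \<le> x \<and> x < fib (2 * l + 2)"
  have "\<not> k < l"
    using fib_mono [of "2 * k + 2" "2 * l"] a b by linarith
  moreover have "\<not> l < k"
    using fib_mono [of "2 * l + 2" "2 * k"] a b by linarith
  ultimately show "k = l" by simp
qed

lemma greedy_sum_le: "(\<Sum>i\<in>{j+1..k}. greedy_coeff x k i * fib (2 * i)) \<le> x"
proof (induction "k - j" arbitrary: j)
  case (Suc d)
  let ?r = "\<Sum>i\<in>{Suc j+1..k}. greedy_coeff x k i * fib (2 * i)"
  have le: "?r \<le> x" using Suc.hyps by (intro Suc.hyps(1)) simp
  have "greedy_coeff x k (Suc j) * fib (2 * Suc j) \<le> x - ?r"
    by (subst greedy_coeff.simps) (rule div_times_less_eq_dividend)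
  moreover have "{j+1..k} = insert (Suc j) {Suc j+1..k}" using Suc.hyps by auto
  ultimately show ?case using le by simp
qed simp

lemma greedy_sum_eq:
  assumes "k \<ge> 1"
  shows "(\<Sum>i = 1..k. greedy_coeff x k i * fib (2 * i)) = x"
proof -
  let ?r = "\<Sum>i\<in>{1+1..k}. greedy_coeff x k i * fib (2 * i)"
  have "greedy_coeff x k 1 = x - ?r"
    by (subst greedy_coeff.simps) simp
  moreover have "?r \<le> x" by (rule greedy_sum_le)
  moreover have "{1..k} = insert 1 {1+1..k}" using assms by auto
  ultimately show ?thesis by simp
qed

end

theory Submission
  imports Defs
begin

text \<open>
  Put \<open>a = V n\<close>, \<open>b = V (n + 1)\<close> and let \<open>\<psi>\<close> be the inverse of the golden ratio.  Each generator is
  \<open>V (n + 2 i) = a F(2i - 1) + b F(2i)\<close>, and \<open>F(2i - 1) = \<psi> F(2i) + \<psi>^(2i)\<close>.  So every element of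
  \<open>S\<close> has the form \<open>a P + b Q\<close> with \<open>\<psi> Q \<le> P\<close>.  For the greedy coefficients of \<open>x\<close> the error
  \<open>\<Sum> \<lambda>\<^sub>i \<psi>^(2i)\<close> is less than 1, so \<open>s(x) = a g + b x\<close> where \<open>g\<close> is the least integer with
  \<open>\<psi> x \<le> g\<close>.  Consequently \<open>S\<close> consists of all \<open>a P + b Q\<close> with \<open>\<psi> Q \<le> P\<close>, and as \<open>a\<close> and \<open>b\<close> are
  coprime, the least element of \<open>S\<close> in the residue class of \<open>b x\<close>, for \<open>0 < x < a\<close>, is \<open>s(x)\<close>.
\<close>

section \<open>Closure of the generated semigroup\<close>

lemma zero_in_nonneg_combinations: "0 \<in> nonneg_combinations A"
  unfolding nonneg_combinations_def by (auto intro!: exI [of _ "{}"])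

lemma mult_in_nonneg_combinations: "v \<in> A \<Longrightarrow> c * v \<in> nonneg_combinations A"
  unfolding nonneg_combinations_def by (auto intro!: exI [of _ "{v}"] exI [of _ "\<lambda>_. c"])

lemma add_in_nonneg_combinations:
  assumes "x \<in> nonneg_combinations A" and "y \<in> nonneg_combinations A"
  shows "x + y \<in> nonneg_combinations A"
proof -
  obtain B c where B: "finite B" "B \<subseteq> A" "x = (\<Sum>a\<in>B. c a * a)"
    using assms(1) unfolding nonneg_combinations_def by blast
  obtain C d where C: "finite C" "C \<subseteq> A" "y = (\<Sum>a\<in>C. d a * a)"
    using assms(2) unfolding nonneg_combinations_def by blast
  \<comment> \<open>Coefficients extended by zero put both sums over the common index set
    \<open>B \<union> C\<close>.\<close>
  let ?c = "\<lambda>a. if a \<in> B then c a else 0"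
  let ?d = "\<lambda>a. if a \<in> C then d a else 0"
  have "x = (\<Sum>a\<in>B \<union> C. ?c a * a)"
    unfolding B(3) using B(1) C(1) by (intro sum.mono_neutral_cong_left) auto
  moreover have "y = (\<Sum>a\<in>B \<union> C. ?d a * a)"
    unfolding C(3) using B(1) C(1) by (intro sum.mono_neutral_cong_left) auto
  ultimately have "x + y = (\<Sum>a\<in>B \<union> C. (?c a + ?d a) * a)"
    by (simp add: sum.distrib distrib_right)
  moreover have "finite (B \<union> C)" "B \<union> C \<subseteq> A" using B C by auto
  ultimately show ?thesis
    unfolding nonneg_combinations_def mem_Collect_eq by (intro exI conjI)
qed

lemma sum_in_nonneg_combinations:
  assumes "\<And>i. i \<in> I \<Longrightarrow> f i \<in> nonneg_combinations A"
  shows "sum f I \<in> nonneg_combinations A"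
  using assms
  by (induction I rule: infinite_finite_induct)
    (auto intro: zero_in_nonneg_combinations add_in_nonneg_combinations)

section \<open>The inverse golden ratio and the error of greedy expansions\<close>

definition inv_golden :: real where
  "inv_golden = (sqrt 5 - 1) / 2"

lemma inv_golden_square: "inv_golden * inv_golden = 1 - inv_golden"
  unfolding inv_golden_def by (simp add: field_simps)

lemma inv_golden_gt_half: "inv_golden > 1 / 2"
proof -
  have "sqrt 5 > sqrt (2 ^ 2)" by (subst real_sqrt_less_iff) simp
  then show ?thesis unfolding inv_golden_def by simp
qed

text \<open>This is \<open>F(2i - 1)\<close>, with the value \<open>F(-1) = 1\<close> at \<open>i = 0\<close>.\<close>

definition fib_odd_pred :: "nat \<Rightarrow> nat" where
  "fib_odd_pred i = fib (2 * i + 1) - fib (2 * i)"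

lemma fib_odd_pred_add: "fib_odd_pred i + fib (2 * i) = fib (2 * i + 1)"
  unfolding fib_odd_pred_def by (cases i) simp_all

text \<open>Since 1 + psi is the golden ratio and -psi its conjugate, psi^(2i) = F(2i + 1) - (1 +
  psi) F(2i); the induction multiplies by psi^2 = 1 - psi.\<close>

lemma fib_odd_pred_eq: "real (fib_odd_pred i) = inv_golden * fib (2 * i) + inv_golden ^ (2 * i)"
proof -
  have "inv_golden ^ (2 * i) = fib (2 * i + 1) - (1 + inv_golden) * fib (2 * i)"
  proof (induction i)
    case (Suc i)
    have "inv_golden ^ (2 * Suc i) = (1 - inv_golden) * inv_golden ^ (2 * i)"
      by (simp flip: inv_golden_square)
    also have "\<dots> = (1 - inv_golden) * fib (2 * i + 1)
        - (1 - inv_golden * inv_golden) * fib (2 * i)"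
      unfolding Suc by (simp add: algebra_simps)
    also have "\<dots> = fib (2 * Suc i + 1) - (1 + inv_golden) * fib (2 * Suc i)"
      unfolding inv_golden_square by (simp add: algebra_simps)
    finally show ?case .
  qed simp
  moreover have "real (fib_odd_pred i) + fib (2 * i) = fib (2 * i + 1)"
    by (metis fib_odd_pred_add of_nat_add)
  ultimately show ?thesis by (simp add: algebra_simps)
qed

text \<open>
  A leading coefficient 2 leaves a remainder below \<open>F(2j + 1)\<close>, not just below \<open>F(2j + 2)\<close>; this is
  why the induction needs the second, sharper bound.
\<close>

lemma greedy_error_bound:
  fixes r c :: "nat \<Rightarrow> nat"
  assumes div: "\<And>j. j < k \<Longrightarrow> c (Suc j) = r (Suc j) div fib (2 * Suc j)"
    and mod: "\<And>j. j < k \<Longrightarrow> r j = r (Suc j) mod fib (2 * Suc j)"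
    and "j \<le> k"
  shows "(r j < fib (2 * j + 2) \<longrightarrow>
           (\<Sum>i = 1..j. c i * inv_golden ^ (2 * i)) \<le> 1 - inv_golden ^ (2 * j + 1)) \<and>
         (r j < fib (2 * j + 1) \<longrightarrow>
           (\<Sum>i = 1..j. c i * inv_golden ^ (2 * i)) \<le> 1 - inv_golden ^ (2 * j))"
  using \<open>j \<le> k\<close>
proof (induction j)
  case 0
  have "inv_golden \<le> 1" unfolding inv_golden_def by (simp add: real_le_lsqrt)
  then show ?case by simp
next
  case (Suc j)
  let ?A = "fib (2 * j + 2)" and ?B = "fib (2 * j + 1)"
  let ?E = "\<lambda>j. \<Sum>i = 1..j. c i * inv_golden ^ (2 * i)"
  define u where "u = inv_golden ^ (2 * j)"
  \<comment> \<open>Writing the powers of psi as u times a linear expression in psi turns every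
    bound below into a linear inequality in u and u psi.\<close>
  have "u > 0" using inv_golden_gt_half unfolding u_def by simp
  have u1: "inv_golden ^ (2 * j + 1) = u * inv_golden" unfolding u_def by simp
  have u2: "inv_golden ^ (2 * Suc j) = u * (1 - inv_golden)"
    unfolding u_def inv_golden_square [symmetric] by simp
  have "inv_golden ^ (2 * Suc j + 1) = inv_golden * (u * (1 - inv_golden))"
    unfolding u2 [symmetric] by simp
  also have "\<dots> = u * (inv_golden - inv_golden * inv_golden)" by (simp add: algebra_simps)
  finally have u3: "inv_golden ^ (2 * Suc j + 1) = u * (2 * inv_golden - 1)"
    unfolding inv_golden_square by simp
  have "?A > 0" by (rule fib_neq_0_nat) simp
  have "?B \<le> ?A" by (rule fib_mono) simp
  have c: "c (Suc j) = r (Suc j) div ?A" and rj: "r j = r (Suc j) mod ?A"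
    using div [of j] mod [of j] Suc.prems by auto
  have r: "r (Suc j) = c (Suc j) * ?A + r j" unfolding c rj by (simp only: div_mult_mod_eq)
  have "r j < ?A" unfolding rj using \<open>?A > 0\<close> by simp
  then have E1: "?E j \<le> 1 - u * inv_golden" using Suc unfolding u1 [symmetric] by simp
  have E2: "?E j \<le> 1 - u" if "r j < ?B" using Suc that u_def by auto
  have E: "?E (Suc j) = ?E j + c (Suc j) * (u * (1 - inv_golden))" unfolding u2 [symmetric] by simp
  have half: "u * inv_golden > u / 2" using inv_golden_gt_half \<open>u > 0\<close> by simp
  have "u * inv_golden < u" using \<open>u > 0\<close> unfolding inv_golden_def
    by (simp add: real_less_lsqrt)
  show ?case
  proof (intro conjI impI)
    assume "r (Suc j) < fib (2 * Suc j + 2)"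
    \<comment> \<open>F(2j + 4) = 2 F(2j + 2) + F(2j + 1), so the digit is at most 2.\<close>
    then have less: "r (Suc j) < 2 * ?A + ?B" by simp
    then have "r (Suc j) < 3 * ?A" using \<open>?B \<le> ?A\<close> by linarith
    then have "c (Suc j) < 3" unfolding c by (rule less_mult_imp_div_less)
    then consider "c (Suc j) = 0" | "c (Suc j) = 1" | "c (Suc j) = 2" by linarith
    then show "?E (Suc j) \<le> 1 - inv_golden ^ (2 * Suc j + 1)"
    proof cases
      case 3
      \<comment> \<open>\<open>E1\<close> would be too weak for digit 2; \<open>E2\<close> gives 1 -
        u + 2u(1 - psi), which equals the target 1 - u(2 psi - 1).\<close>
      then have "r j < ?B" using less r by simp
      from E2 [OF this] show ?thesis unfolding E u3 using 3 by (simp add: algebra_simps)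
    qed (use E1 \<open>u * inv_golden < u\<close> in \<open>simp_all only: E u3, simp_all add: algebra_simps\<close>)
  next
    assume "r (Suc j) < fib (2 * Suc j + 1)"
    \<comment> \<open>F(2j + 3) = F(2j + 2) + F(2j + 1) allows only digits 0 and 1; both cases
      reduce to 1 - psi <= psi, which is \<open>half\<close>.\<close>
    then have less: "r (Suc j) < ?A + ?B" by simp
    then have "r (Suc j) < 2 * ?A" using \<open>?B \<le> ?A\<close> by linarith
    then have "c (Suc j) < 2" unfolding c by (rule less_mult_imp_div_less)
    then consider "c (Suc j) = 0" | "c (Suc j) = 1" by linarith
    then show "?E (Suc j) \<le> 1 - inv_golden ^ (2 * Suc j)"
    proof cases
      case 1
      then show ?thesis unfolding E u2 using E1 half by (simp add: algebra_simps)
    next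
      case 2
      then have "r j < ?B" using less r by simp
      from E2 [OF this] show ?thesis unfolding E u2 using 2 half by (simp add: algebra_simps)
    qed
  qed
qed

text \<open>The greedy remainders, starting from \<open>r k = x\<close>, satisfy the recursion of
  \<open>greedy_error_bound\<close>; the positive power of psi subtracted there makes the inequality
  strict.\<close>

lemma greedy_coeff_error:
  assumes "x < fib (2 * k + 2)"
  shows "(\<Sum>i = 1..k. greedy_coeff x k i * inv_golden ^ (2 * i)) < 1"
proof -
  define r where "r j = x - (\<Sum>i\<in>{j+1..k}. greedy_coeff x k i * fib (2 * i))" for j
  have coeff: "greedy_coeff x k j = r j div fib (2 * j)" for j
    unfolding r_def by (rule greedy_coeff.simps)
  have "r j = r (Suc j) mod fib (2 * Suc j)" if "j < k" for j
  proof -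
    have "{j+1..k} = insert (Suc j) {Suc j+1..k}" using that by auto
    then have "r j = r (Suc j) - greedy_coeff x k (Suc j) * fib (2 * Suc j)"
      unfolding r_def by simp
    then show ?thesis unfolding coeff by (simp only: minus_div_mult_eq_mod)
  qed
  moreover have "r k < fib (2 * k + 2)" using assms unfolding r_def by simp
  ultimately have "(\<Sum>i = 1..k. greedy_coeff x k i * inv_golden ^ (2 * i))
      \<le> 1 - inv_golden ^ (2 * k + 1)"
    using greedy_error_bound [of k "greedy_coeff x k" r k] coeff by blast
  moreover have "inv_golden ^ (2 * k + 1) > 0"
    using inv_golden_gt_half by (intro zero_less_power) simp
  ultimately show ?thesis by simp
qed

section \<open>Coordinates of the semigroup with respect to \<open>V n\<close> and
  \<open>V (n + 1)\<close>\<close>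

lemma fib_like_even:
  fixes V :: "nat \<Rightarrow> nat"
  assumes "\<And>m. m \<ge> n \<Longrightarrow> V (m + 2) = V (m + 1) + V m"
  shows "V (n + 2 * i) = V n * fib_odd_pred i + V (n + 1) * fib (2 * i)"
proof -
  have V: "V (n + Suc m) = V n * fib m + V (n + 1) * fib (Suc m)" for m
  proof (induction m rule: fib.induct)
    case (3 m)
    have "V (n + Suc (Suc (Suc m))) = V (n + Suc (Suc m)) + V (n + Suc m)"
      using assms [of "n + Suc m"] by simp
    then show ?case using 3 by (simp add: algebra_simps)
  qed (use assms [of n] in auto)
  show ?thesis
  proof (cases i)
    case (Suc j)
    have "fib_odd_pred i = fib (2 * j + 1)" unfolding fib_odd_pred_def Suc by simp
    then show ?thesis using V [of "2 * j + 1"] Suc by simp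
  qed (simp add: fib_odd_pred_def)
qed

text \<open>The two bounds say that the error lies in [0, 1). They determine the integer
  \<open>g\<close> from \<open>x\<close> alone, so the digits can be forgotten from here on.\<close>

lemma greedy_s_eq:
  assumes V: "\<And>m. m \<ge> n \<Longrightarrow> V (m + 2) = V (m + 1) + V m" and "x > 0"
  obtains g where "greedy_s V n x = V n * g + V (n + 1) * x"
    and "inv_golden * x \<le> g" and "g < inv_golden * x + 1"
proof -
  define k where "k = greedy_top x"
  have k: "k \<ge> 1" "x < fib (2 * k + 2)"
    using theI' [OF greedy_top_ex1 [OF \<open>x > 0\<close>]] unfolding k_def greedy_top_def by auto
  let ?c = "greedy_coeff x k"
  define g where "g = (\<Sum>i = 1..k. ?c i * fib_odd_pred i)"
  have x: "(\<Sum>i = 1..k. ?c i * fib (2 * i)) = x" using k(1) by (rule greedy_sum_eq)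
  have "greedy_s V n x = (\<Sum>i = 1..k. ?c i * (V n * fib_odd_pred i + V (n + 1) * fib (2 * i)))"
    unfolding greedy_s_def k_def [symmetric] using fib_like_even [of n V, OF V] by simp
  also have "\<dots> = V n * g + V (n + 1) * (\<Sum>i = 1..k. ?c i * fib (2 * i))"
    unfolding g_def by (simp add: sum_distrib_left sum.distrib algebra_simps)
  finally have s: "greedy_s V n x = V n * g + V (n + 1) * x" unfolding x .
  let ?e = "\<Sum>i = 1..k. ?c i * inv_golden ^ (2 * i)"
  have "real g = inv_golden * real (\<Sum>i = 1..k. ?c i * fib (2 * i)) + ?e"
    unfolding g_def by (simp add: fib_odd_pred_eq sum_distrib_left sum.distrib algebra_simps)
  then have "real g = inv_golden * x + ?e" unfolding x .
  moreover have "?e < 1" using k(2) by (rule greedy_coeff_error)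
  moreover have "?e \<ge> 0" using inv_golden_gt_half by (intro sum_nonneg) simp
  ultimately show ?thesis by (intro that [OF s]) linarith+
qed

text \<open>The inequality passes from generators to sums. Conversely, for \<open>q > 0\<close>, the
  coefficient \<open>p\<close> is at least the minimal one realised by s(q), and the surplus is made
  up by copies of \<open>V n\<close>.\<close>

lemma nonneg_combinations_fib_like:
  fixes V :: "nat \<Rightarrow> nat"
  assumes V: "\<And>m. m \<ge> n \<Longrightarrow> V (m + 2) = V (m + 1) + V m"
  shows "nonneg_combinations {V (n + 2 * i) | i. True}
       = {V n * p + V (n + 1) * q | p q. inv_golden * q \<le> p}"
    (is "?S = ?T")
proof (intro equalityI subsetI)
  have add: "x + y \<in> ?T" if "x \<in> ?T" "y \<in> ?T" for x y
  proof -
    from that obtain p q p' q' where "x = V n * p + V (n + 1) * q" "inv_golden * q \<le> p"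
      "y = V n * p' + V (n + 1) * q'" "inv_golden * q' \<le> p'" by blast
    then have "x + y = V n * (p + p') + V (n + 1) * (q + q')"
      "inv_golden * real (q + q') \<le> real (p + p')"
      by (simp_all add: algebra_simps)
    then show ?thesis by blast
  qed
  have zero: "0 \<in> ?T" by (auto intro!: exI [of _ 0])
  have gen: "c * V (n + 2 * i) \<in> ?T" for c i
  proof -
    have "c * V (n + 2 * i) = V n * (c * fib_odd_pred i) + V (n + 1) * (c * fib (2 * i))"
      using fib_like_even [of n V i, OF V] by (simp add: algebra_simps)
    moreover have "inv_golden * real (c * fib (2 * i)) \<le> real (c * fib_odd_pred i)"
      using inv_golden_gt_half by (simp add: fib_odd_pred_eq algebra_simps)
    ultimately show ?thesis by blast
  qed
  fix m
  assume "m \<in> ?S"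
  then obtain B c where B: "finite B" "B \<subseteq> {V (n + 2 * i) | i. True}" "m = (\<Sum>a\<in>B. c a * a)"
    unfolding nonneg_combinations_def by blast
  from B(1,2) have "(\<Sum>a\<in>B. c a * a) \<in> ?T"
  proof (induction B rule: finite_induct)
    case (insert v B)
    then have "c v * v \<in> ?T" using gen by blast
    with insert show ?case using add by simp
  qed (use zero in simp)
  then show "m \<in> ?T" unfolding B(3) .
next
  fix m
  assume "m \<in> ?T"
  then obtain p q where m: "m = V n * p + V (n + 1) * q" and pq: "inv_golden * q \<le> p" by blast
  have multiple: "c * V (n + 2 * i) \<in> ?S" for c i
    by (rule mult_in_nonneg_combinations) blast
  have multiple_Vn: "V n * c \<in> ?S" for c using multiple [of c 0] by (simp add: mult.commute)
  show "m \<in> ?S"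
  proof (cases "q = 0")
    case True
    then show ?thesis using m multiple_Vn by simp
  next
    case False
    then obtain g where g: "greedy_s V n q = V n * g + V (n + 1) * q" "g < inv_golden * q + 1"
      using greedy_s_eq [of n V q, OF V] by blast
    have "g \<le> p" using g(2) pq by linarith
    then have "V n * p = V n * g + V n * (p - g)" by (simp flip: distrib_left)
    then have "m = greedy_s V n q + V n * (p - g)" unfolding m g(1) by simp
    moreover have "greedy_s V n q \<in> ?S"
      unfolding greedy_s_def by (rule sum_in_nonneg_combinations) (rule multiple)
    ultimately show ?thesis using multiple_Vn by (simp only: add_in_nonneg_combinations)
  qed
qed

section \<open>Coprime consecutive terms and the Apery set\<close>

lemma fib_like_coprime:
  fixes V :: "nat \<Rightarrow> nat"
  assumes "coprime (V 1) (V 2)" and "\<And>m. m \<ge> 1 \<Longrightarrow> V (m + 2) = V (m + 1) + V m" and "n \<ge> 1"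
  shows "coprime (V n) (V (n + 1))"
  using \<open>n \<ge> 1\<close>
proof (induction n rule: dec_induct)
  case base
  then show ?case using assms(1) by (simp add: numeral_2_eq_2)
next
  case (step n)
  then show ?case using assms(2) [of n]
    by (simp add: coprime_iff_gcd_eq_1 gcd.commute)
qed

lemma fib_like_pos:
  fixes V :: "nat \<Rightarrow> nat"
  assumes "V 1 > 0" and "V 2 > 0" and "\<And>m. m \<ge> 1 \<Longrightarrow> V (m + 2) = V (m + 1) + V m" and "n \<ge> 1"
  shows "V n > 0"
proof -
  have "V n > 0 \<and> V (n + 1) > 0" using \<open>n \<ge> 1\<close>
    by (induction n rule: dec_induct) (use assms in \<open>auto simp: numeral_2_eq_2\<close>)
  then show ?thesis ..
qed

theorem theorem4p6:
  fixes V :: "nat \<Rightarrow> nat" and n :: nat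
  assumes "V 1 > 0" and "V 2 > 0"
    and "gcd (V 1) (V 2) = 1"
    and "\<And>m. m \<ge> 3 \<Longrightarrow> V m = V (m - 1) + V (m - 2)"
    and "n \<ge> 1"
  shows "apery_set (nonneg_combinations {V (n + 2 * i) | i. True}) (V n)
       = {greedy_s V n x | x. 1 \<le> x \<and> x \<le> V n - 1} \<union> {0}"
proof -
  have rec1: "V (m + 2) = V (m + 1) + V m" if "m \<ge> 1" for m
    using assms(4) [of "m + 2"] that by simp
  then have rec: "V (m + 2) = V (m + 1) + V m" if "m \<ge> n" for m using that assms(5) by simp
  define a b where "a = V n" and "b = V (n + 1)"
  have "a > 0" unfolding a_def using fib_like_pos [of V, OF assms(1,2) rec1 assms(5)] .
  have "coprime a b" unfolding a_def b_def
    using fib_like_coprime [of V, OF _ rec1 assms(5)] assms(3) by (simp add: coprime_iff_gcd_eq_1)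
  define S where "S = nonneg_combinations {V (n + 2 * i) | i. True}"
  have S: "S = {a * p + b * q | p q. inv_golden * q \<le> p}"
    unfolding S_def a_def b_def by (rule nonneg_combinations_fib_like) (rule rec)
  have in_S: "a * p + b * q \<in> S" if "inv_golden * q \<le> p" for p q unfolding S using that by blast
  have psi: "inv_golden > 0" using inv_golden_gt_half by simp
  have "apery_set S a = {greedy_s V n x | x. 1 \<le> x \<and> x \<le> a - 1} \<union> {0}"
  proof (intro equalityI subsetI)
    fix m
    assume "m \<in> apery_set S a"
    then have "m \<in> S" and notin: "int m - int a \<notin> int ` S" unfolding apery_set_def by auto
    then obtain p q where m: "m = a * p + b * q" and pq: "inv_golden * q \<le> p"
      unfolding S by blast
    define x where "x = q mod a"
    \<comment> \<open>The part of \<open>q\<close> divisible by \<open>a\<close> is moved into the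
      coefficient of \<open>a\<close>.\<close>
    define P where "P = p + (q div a) * b"
    have "b * q = b * (q div a * a + x)" unfolding x_def by simp
    then have m': "m = a * P + b * x" unfolding m P_def by (simp add: algebra_simps)
    have "inv_golden * x \<le> inv_golden * q" unfolding x_def using psi by simp
    also have "\<dots> \<le> P" using pq unfolding P_def by (simp add: add_increasing2)
    finally have xP: "inv_golden * x \<le> P" .
    \<comment> \<open>Otherwise \<open>P - 1\<close> would still be admissible, placing
      \<open>m - a\<close> in \<open>S\<close>.\<close>
    have small: "P < inv_golden * x + 1"
    proof (rule ccontr)
      assume "\<not> P < inv_golden * x + 1"
      then have le: "inv_golden * x + 1 \<le> P" by simp
      moreover have "inv_golden * x \<ge> 0" using psi by simp
      ultimately have "P \<ge> 1" by linarith
      then have "a * P = a * (P - 1) + a" by (simp add: algebra_simps)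
      then have "int m - int a = int (a * (P - 1) + b * x)" unfolding m' by simp
      moreover have "a * (P - 1) + b * x \<in> S" using le \<open>P \<ge> 1\<close> by (intro in_S) (simp add: of_nat_diff)
      ultimately show False using notin by blast
    qed
    show "m \<in> {greedy_s V n x | x. 1 \<le> x \<and> x \<le> a - 1} \<union> {0}"
    proof (cases "x = 0")
      case True
      then show ?thesis using small m' by simp
    next
      case False
      then obtain g where g: "greedy_s V n x = a * g + b * x"
        "inv_golden * x \<le> g" "g < inv_golden * x + 1"
        using greedy_s_eq [of n V x, OF rec] unfolding a_def b_def by blast
      \<comment> \<open>A half-open interval of length 1 contains only one integer.\<close>
      then have "g = P" using small xP by linarith
      then have "m = greedy_s V n x" using g m' by simp
      moreover have "x < a" unfolding x_def using \<open>a > 0\<close> by simp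
      ultimately show ?thesis using False by fastforce
    qed
  next
    fix m
    assume m: "m \<in> {greedy_s V n x | x. 1 \<le> x \<and> x \<le> a - 1} \<union> {0}"
    show "m \<in> apery_set S a"
    proof (cases "m = 0")
      case True
      then show ?thesis
        using zero_in_nonneg_combinations \<open>a > 0\<close> unfolding apery_set_def S_def by auto
    next
      case False
      then obtain x where x: "m = greedy_s V n x" "1 \<le> x" "x < a" using m \<open>a > 0\<close> by fastforce
      then obtain g where g: "m = a * g + b * x"
        "inv_golden * x \<le> g" "g < inv_golden * x + 1"
        using greedy_s_eq [of n V x, OF rec] unfolding a_def b_def by force
      have "int m - int a \<notin> int ` S"
      proof
        assume "int m - int a \<in> int ` S"
        then obtain p q where "int m - int a = int (a * p + b * q)" and pq: "inv_golden * q \<le> p"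
          unfolding S by blast
        then have eq: "int b * (int q - int x) = int a * (int g - 1 - int p)"
          unfolding g(1) by (simp add: algebra_simps)
        then have "int a dvd int b * (int q - int x)" by simp
        then have "int a dvd int q - int x"
          using \<open>coprime a b\<close> by (simp add: coprime_dvd_mult_right_iff)
        then obtain t where t: "int q - int x = int a * t" ..
        \<comment> \<open>If t <= -1, then q <= x - a < 0.\<close>
        have "t \<ge> 0"
        proof (rule ccontr)
          assume "\<not> t \<ge> 0"
          then have "int a * t \<le> int a * (- 1)" by (intro mult_left_mono) auto
          then show False using t x(3) by linarith
        qed
        \<comment> \<open>Thus \<open>q\<close> is at least \<open>x\<close>, which forces
          \<open>p\<close> below \<open>g\<close>; then p <= g - 1 < psi x <= psi q contradicts
          \<open>pq\<close>.\<close>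
        then have "int x \<le> int q" using t by (metis diff_ge_0_iff_ge of_nat_0_le_iff mult_nonneg_nonneg)
        then have "int a * (int g - 1 - int p) \<ge> 0" unfolding eq [symmetric] by simp
        then have "int p \<le> int g - 1" using \<open>a > 0\<close> by (simp add: zero_le_mult_iff)
        then have "real p \<le> real g - 1" by linarith
        also have "\<dots> < inv_golden * x" using g(3) by simp
        also have "\<dots> \<le> inv_golden * q" using \<open>int x \<le> int q\<close> psi by simp
        finally show False using pq by simp
      qed
      then show ?thesis using in_S g unfolding apery_set_def by blast
    qed
  qed
  then show ?thesis unfolding S_def a_def .
qed

end
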